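(* For every rational number $r$ in $[1,2)$, there exists a finite simple graph $G$ such that $$\frac{b_g(G)}{b(G)} = r.$$
   Context: All graphs are finite, simple and undirected. A configuration of a graph $G$ is a map $f: V(G) \to \mathbb{N}\cup\{0\}$, where $f(v)$ is the number of brushes on $v$. Starting from a configuration with all vertices dirty, a dirty vertex $v$ may fire (be cleaned) when it has at least as many brushes as dirty neighbors; when it fires, one brush is added to each dirty neighbor of $v$, and $v$ is marked clean. $G$ can be cleaned by $f$ if some sequence of vertex firings, starting from $f$, results in every vertex being clean. The brush number $b(G)$ is the minimum of $\sum_{v} f(v)$ over all configurations $f$ by which $G$ can be cleaned. The brushing game on $G$ is played by two players, Max and Min. Initially all vertices are dirty and no vertex contains any brushes. The players alternate turns. On each turn, the player whose turn it is adds one brush to any dirty vertex; then vertices that are able to fire do so, sequentially (in an arbitrary order; the order does not affect the outcome), until no more vertices may fire, at which point the turn ends. If at this point all vertices of $G$ are clean, the game ends. The length of the game is the number of brushes placed by the players (the number of turns). Min aims to minimize it, Max aims to maximize it. The game brush number $b_g(G)$ is the length of the game when Min takes the first turn and both players play optimally. *)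

theory Defs
  imports "Graph_Theory.Pair_Digraph"
begin

text \<open>Finite simple undirected graphs are the library's \<^locale>\<open>pair_graph\<close>: an edge
  between \<open>u\<close> and \<open>v\<close> is the pair of opposite arcs \<open>(u, v)\<close>, \<open>(v, u)\<close>.\<close>

type_synonym 'a state = "('a \<Rightarrow> nat) \<times> 'a set"  \<comment> \<open>brushes on each vertex, set of dirty vertices\<close>

definition dirty_nbrs :: "'a pair_pre_digraph \<Rightarrow> 'a set \<Rightarrow> 'a \<Rightarrow> 'a set" where
  "dirty_nbrs G D v = {w \<in> D. (v, w) \<in> parcs G}"

inductive fires :: "'a pair_pre_digraph \<Rightarrow> 'a state \<Rightarrow> 'a state \<Rightarrow> bool" for G where
  "v \<in> D \<Longrightarrow> card (dirty_nbrs G D v) \<le> f v \<Longrightarrow>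
   fires G (f, D) (\<lambda>w. if w \<in> dirty_nbrs G D v then f w + 1 else f w, D - {v})"

definition cleans :: "'a pair_pre_digraph \<Rightarrow> ('a \<Rightarrow> nat) \<Rightarrow> bool" where
  "cleans G f \<longleftrightarrow> (\<exists>f'. (fires G)\<^sup>*\<^sup>* (f, pverts G) (f', {}))"

text \<open>Brushes outside \<open>pverts G\<close> play no role, so total functions serve as configurations.\<close>

definition brush_number :: "'a pair_pre_digraph \<Rightarrow> nat" where
  "brush_number G = (LEAST n. \<exists>f. cleans G f \<and> n = (\<Sum>v\<in>pverts G. f v))"

definition stable :: "'a pair_pre_digraph \<Rightarrow> 'a state \<Rightarrow> bool" where
  "stable G s \<longleftrightarrow> (\<nexists>s'. fires G s s')"

text \<open>The firing order is arbitrary. By \<open>settled_unique\<close> below, it affects neither the dirty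
  vertices of the resulting stable state nor the brushes on them; the brushes left on clean vertices
  may depend on it, but they never matter again.\<close>

definition settle :: "'a pair_pre_digraph \<Rightarrow> 'a state \<Rightarrow> 'a state" where
  "settle G s = (SOME s'. (fires G)\<^sup>*\<^sup>* s s' \<and> stable G s')"

definition turn :: "'a pair_pre_digraph \<Rightarrow> 'a \<Rightarrow> 'a state \<Rightarrow> 'a state" where
  "turn G v s = settle G ((fst s)(v := fst s v + 1), snd s)"

lemma fires_dirty:
  assumes "fires G s s'"
  shows "snd s' \<subset> snd s"
  using assms by cases auto

lemma fires_rtranclp_dirty:
  assumes "(fires G)\<^sup>*\<^sup>* s s'"
  shows "s' = s \<or> snd s' \<subset> snd s"
  using assms by induction (auto dest: fires_dirty)

lemma settled_exists:
  assumes "finite (snd s)"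
  shows "\<exists>s'. (fires G)\<^sup>*\<^sup>* s s' \<and> stable G s'"
  using assms
proof (induction "card (snd s)" arbitrary: s rule: less_induct)
  case less
  show ?case
  proof (cases "stable G s")
    case False
    then obtain t where t: "fires G s t" unfolding stable_def by blast
    from fires_dirty[OF t] less.prems have "card (snd t) < card (snd s)" "finite (snd t)"
      by (auto intro: psubset_card_mono finite_subset)
    from less.hyps[OF this] t show ?thesis by (meson converse_rtranclp_into_rtranclp)
  qed blast
qed

lemma settle:
  assumes "finite (snd s)"
  shows "(fires G)\<^sup>*\<^sup>* s (settle G s)" "stable G (settle G s)"
  using someI_ex[OF settled_exists[OF assms, of G]] unfolding settle_def by auto

lemma fires_rtranclp_brushes:
  assumes "(fires G)\<^sup>*\<^sup>* (f, D) s'" "finite D"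
  shows "snd s' \<subseteq> D \<and> (\<forall>w\<in>snd s'. fst s' w = f w + card {u \<in> D - snd s'. (u, w) \<in> parcs G})"
  using assms(1)
proof induction
  case (step s t)
  obtain v where v: "v \<in> snd s"
    and t: "t = (\<lambda>w. if w \<in> dirty_nbrs G (snd s) v then fst s w + 1 else fst s w, snd s - {v})"
    using step.hyps(2) by cases fastforce
  have "fst t w = f w + card {u \<in> D - snd t. (u, w) \<in> parcs G}" if w: "w \<in> snd t" for w
  proof -
    have "{u \<in> D - snd t. (u, w) \<in> parcs G} =
        {u \<in> D - snd s. (u, w) \<in> parcs G} \<union> (if (v, w) \<in> parcs G then {v} else {})"
      using v step.IH t by auto
    then show ?thesis
      using w v step.IH t assms(2) by (auto simp: dirty_nbrs_def card_insert_if)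
  qed
  then show ?case using step.IH t by auto
qed auto

lemma settled_dirty_subset:
  assumes "(fires G)\<^sup>*\<^sup>* (f, D) s1" "(fires G)\<^sup>*\<^sup>* (f, D) s2" "stable G s2" "finite D"
  shows "snd s2 \<subseteq> snd s1"
  using assms(1)
proof induction
  case base
  then show ?case using fires_rtranclp_dirty[OF assms(2)] by auto
next
  case (step s t)
  obtain v where v: "v \<in> snd s" "card (dirty_nbrs G (snd s) v) \<le> fst s v" "snd t = snd s - {v}"
    using step.hyps(2) by cases fastforce
  have "v \<notin> snd s2"
  proof
    assume v2: "v \<in> snd s2"
    note i1 = fires_rtranclp_brushes[OF step.hyps(1) assms(4)]
    note i2 = fires_rtranclp_brushes[OF assms(2,4)]
    have fin: "finite (snd s)" using i1 assms(4) finite_subset by blast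
    have "card (dirty_nbrs G (snd s2) v) \<le> card (dirty_nbrs G (snd s) v)"
      using step.IH fin by (intro card_mono) (auto simp: dirty_nbrs_def)
    also have "\<dots> \<le> fst s v" by (fact v)
    also have "\<dots> \<le> fst s2 v"
    proof -
      have "card {u \<in> D - snd s. (u, v) \<in> parcs G} \<le> card {u \<in> D - snd s2. (u, v) \<in> parcs G}"
        using step.IH assms(4) by (intro card_mono) auto
      then show ?thesis using i1 i2 v v2 by auto
    qed
    finally show False
      using assms(3) v2 fires.intros[of v "snd s2" G "fst s2"] unfolding stable_def by auto
  qed
  then show ?case using step.IH v by auto
qed

lemma settled_unique:
  assumes "(fires G)\<^sup>*\<^sup>* (f, D) s1" "stable G s1"
    and "(fires G)\<^sup>*\<^sup>* (f, D) s2" "stable G s2" and "finite D"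
  shows "snd s1 = snd s2" "\<forall>w\<in>snd s1. fst s1 w = fst s2 w"
proof -
  show *: "snd s1 = snd s2"
    using settled_dirty_subset assms by (metis subset_antisym)
  show "\<forall>w\<in>snd s1. fst s1 w = fst s2 w"
    using fires_rtranclp_brushes[OF assms(1,5)] fires_rtranclp_brushes[OF assms(3,5)] * by auto
qed

lemma turn_dirty_or_stuck:
  assumes "finite (snd s)" "v \<in> snd s"
  shows "snd (turn G v s) \<subset> snd s \<or>
    turn G v s = ((fst s)(v := fst s v + 1), snd s) \<and> fst s v + 1 < card (snd s)"
proof -
  let ?s = "((fst s)(v := fst s v + 1), snd s)"
  have fin: "finite (snd ?s)" using assms by simp
  show ?thesis
  proof (cases "turn G v s = ?s")
    case True
    then have "stable G ?s" using settle(2)[OF fin, of G] by (simp add: turn_def)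
    then have "\<not> card (dirty_nbrs G (snd s) v) \<le> fst s v + 1"
      using fires.intros[of v "snd s" G "fst ?s"] assms(2) unfolding stable_def by auto
    moreover have "card (dirty_nbrs G (snd s) v) \<le> card (snd s)"
      using assms(1) by (intro card_mono) (auto simp: dirty_nbrs_def)
    ultimately show ?thesis using True by auto
  next
    case False
    then show ?thesis
      using fires_rtranclp_dirty[OF settle(1)[OF fin, of G]] by (auto simp: turn_def)
  qed
qed

text \<open>The number of turns still to be played from a state under optimal play; the Boolean tells
  whether it is Min's turn. The case of infinitely many dirty vertices is only there for totality.\<close>

function game_length :: "'a pair_pre_digraph \<Rightarrow> bool \<Rightarrow> 'a state \<Rightarrow> nat" where
  "game_length G mins_turn s =
    (if snd s = {} \<or> infinite (snd s) then 0
     else 1 + (if mins_turn then Min else Max)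
                ((\<lambda>v. game_length G (\<not> mins_turn) (turn G v s)) ` snd s))"
  by pat_completeness auto

termination
proof (relation "inv_image (less_than <*lex*> less_than)
    (\<lambda>(G, m, s). (card (snd s), \<Sum>w\<in>snd s. card (snd s) - fst s w))", goal_cases)
  case 1
  then show ?case by auto
next
  case (2 G m s v)
  then have fin: "finite (snd s)" by auto
  from turn_dirty_or_stuck[OF fin 2(2), of G] show ?case
  proof
    assume "snd (turn G v s) \<subset> snd s"
    then show ?thesis using fin by (auto simp: psubset_card_mono)
  next
    assume a: "turn G v s = ((fst s)(v := fst s v + 1), snd s) \<and> fst s v + 1 < card (snd s)"
    have "(\<Sum>w\<in>snd s. card (snd s) - ((fst s)(v := fst s v + 1)) w)
        < (\<Sum>w\<in>snd s. card (snd s) - fst s w)"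
      using fin 2(2) a by (intro sum_strict_mono_ex1) auto
    then show ?thesis using a by auto
  qed
qed

declare game_length.simps [simp del]

definition game_brush_number :: "'a pair_pre_digraph \<Rightarrow> nat" where
  "game_brush_number G = game_length G True (\<lambda>_. 0, pverts G)"

lemma cleans_exists:
  assumes "finite (pverts G)"
  shows "\<exists>f. cleans G f"
proof -
  define n where "n = card (pverts G)"
  have "\<exists>f'. (fires G)\<^sup>*\<^sup>* (f, D) (f', {})" if "finite D" "card D \<le> n" "\<forall>w. n \<le> f w" for D f
    using that
  proof (induction D arbitrary: f rule: finite_induct)
    case (insert v D)
    let ?f = "\<lambda>w. if w \<in> dirty_nbrs G (insert v D) v then f w + 1 else f w"
    have "card (dirty_nbrs G (insert v D) v) \<le> card (insert v D)"
      using insert.hyps by (intro card_mono) (auto simp: dirty_nbrs_def)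
    also have "\<dots> \<le> f v" using insert.prems order_trans by blast
    finally have "fires G (f, insert v D) (?f, insert v D - {v})" by (intro fires.intros) auto
    then have *: "fires G (f, insert v D) (?f, D)" using insert.hyps by simp
    have "card D \<le> n" "\<forall>w. n \<le> ?f w" using insert by (auto simp: le_SucI)
    from insert.IH[OF this] * show ?case by (meson converse_rtranclp_into_rtranclp)
  qed auto
  from this[of "pverts G" "\<lambda>_. n"] assms show ?thesis unfolding cleans_def n_def by blast
qed

end

theory Submission
  imports Defs
begin

text \<open>
  Fix \<open>n > 0\<close> and take three hubs \<open>a\<close>, \<open>c\<close>, \<open>b\<close>, with \<open>n\<close> parallel paths of length two between \<open>a\<close>
  and \<open>c\<close>, another \<open>n\<close> between \<open>c\<close> and \<open>b\<close>, and \<open>t\<close> disjoint edges as further components. So \<open>a\<close> and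
  \<open>b\<close> have degree \<open>n\<close>, while \<open>c\<close> has degree \<open>2 n\<close>.

  The brush number is \<open>n + t\<close>. Each isolated edge needs one brush. With \<open>n\<close> brushes on \<open>a\<close>, the rest
  of the large component is swept for free from one end to the other. Fewer than \<open>n\<close>
  brushes do not suffice: a middle vertex of a path that fires before its hubs costs two brushes and
  improves the balance of a hub by two (one brush more, one dirty neighbour fewer), so the first hub to
  fire has to be paid for by as many brushes, on the hub and on the paths at it, as its degree.

  Since \<open>c\<close> has twice the degree of \<open>a\<close> and \<open>b\<close>, Max can waste \<open>n - 1\<close> brushes on it. If \<open>c\<close> is then
  the first hub to fire, the large component has received \<open>2 n\<close> brushes; otherwise it has received at
  least \<open>n\<close> at one of the ends, in addition to the \<open>n - 1\<close> on \<open>c\<close>. Min in turn places brushes on \<open>a\<close>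
  until it is clean, which takes at most \<open>n\<close> moves and leaves only isolated edges, each of
  them gone after one move. Hence the game brush number is \<open>2 n - 1 + t\<close>, and
  the ratio is \<open>1 + (n - 1) / (n + t)\<close>; every rational in \<open>[1, 2)\<close> has this form.

  Both analyses reduce to statements about the brushes that have been placed so far, because these
  determine the dirty vertices: they form the largest blocked set (\<open>position_blocked\<close> and
  \<open>position_blocked_subset\<close>), a blocked set being one none of whose vertices can be the first
  of the set to fire. Strategies then become an invariant for Max
  (\<open>game_length_ge_if_Max_strategy\<close>) and a potential for Min (\<open>game_length_le_if_Min_strategy\<close>).
\<close>

section \<open>Blocked sets\<close>

definition nbrs :: "'a pair_pre_digraph \<Rightarrow> 'a \<Rightarrow> 'a set" where
  "nbrs G w = {u. (w, u) \<in> parcs G}"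

text \<open>The left side of the inequality is the supply of \<open>w\<close> when everything outside \<open>D\<close> has fired, the
  right side its demand: even under these most favourable circumstances no vertex of \<open>D\<close> can
  fire.\<close>

definition blocked :: "'a pair_pre_digraph \<Rightarrow> ('a \<Rightarrow> nat) \<Rightarrow> 'a set \<Rightarrow> bool" where
  "blocked G g D \<longleftrightarrow> D \<subseteq> pverts G \<and>
     (\<forall>w\<in>D. g w + card (nbrs G w - D) < card (nbrs G w \<inter> D))"

text \<open>The states of the game, described by the brushes \<open>g\<close> that the players have placed in total: placing
  them one at a time and settling in between amounts to placing all of them at the start.\<close>

definition position :: "'a pair_pre_digraph \<Rightarrow> ('a \<Rightarrow> nat) \<Rightarrow> 'a state \<Rightarrow> bool" where
  "position G g s \<longleftrightarrow> (fires G)\<^sup>*\<^sup>* (g, pverts G) s \<and> stable G s"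

lemma sum_add_brush:
  fixes g :: "'a \<Rightarrow> nat"
  assumes "finite S"
  shows "(\<Sum>x\<in>S. (g(v := g v + 1)) x) = (\<Sum>x\<in>S. g x) + (if v \<in> S then 1 else 0)"
proof -
  have "(\<Sum>x\<in>S. (g(v := g v + 1)) x) = (\<Sum>x\<in>S. g x + (if x = v then 1 else 0))"
    by (intro sum.cong) auto
  also have "\<dots> = (\<Sum>x\<in>S. g x) + (if v \<in> S then 1 else 0)"
    using assms by (simp add: sum.distrib)
  finally show ?thesis .
qed

context pair_graph
begin

lemma nbrs_subset: "nbrs G w \<subseteq> pverts G"
  by (auto simp: nbrs_def dest: in_arcsD2)

lemma finite_nbrs: "finite (nbrs G w)"
  by (rule finite_subset[OF nbrs_subset finite_verts])

lemma dirty_nbrs_eq: "dirty_nbrs G D w = nbrs G w \<inter> D"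
  by (auto simp: dirty_nbrs_def nbrs_def)

lemma brushes_on_dirty:
  assumes "(fires G)\<^sup>*\<^sup>* (g, pverts G) s"
  shows "snd s \<subseteq> pverts G" "w \<in> snd s \<Longrightarrow> fst s w = g w + card (nbrs G w - snd s)"
proof -
  note * = fires_rtranclp_brushes[OF assms]
  show "snd s \<subseteq> pverts G" using * by simp
  have "{u \<in> pverts G - snd s. (u, w) \<in> parcs G} = nbrs G w - snd s"
    using nbrs_subset[of w] arcs_symmetric by (auto simp: nbrs_def)
  then show "w \<in> snd s \<Longrightarrow> fst s w = g w + card (nbrs G w - snd s)" using * by simp
qed

text \<open>When the first vertex of \<open>D\<close> fires, all of \<open>D\<close> is still dirty, so its brushes are at most the supply
  and its dirty neighbours at least the demand in the definition of a blocked set.\<close>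

lemma blocked_subset_dirty:
  assumes "(fires G)\<^sup>*\<^sup>* (g, pverts G) s" "blocked G g D"
  shows "D \<subseteq> snd s"
  using assms(1)
proof induction
  case base
  then show ?case using assms(2) by (simp add: blocked_def)
next
  case (step s t)
  obtain v where v: "v \<in> snd s" "card (nbrs G v \<inter> snd s) \<le> fst s v" "snd t = snd s - {v}"
    using step.hyps(2) by cases (auto simp: dirty_nbrs_eq)
  have "v \<notin> D"
  proof
    assume "v \<in> D"
    have "card (nbrs G v \<inter> D) \<le> card (nbrs G v \<inter> snd s)"
      using step.IH finite_nbrs by (intro card_mono) auto
    also have "\<dots> \<le> g v + card (nbrs G v - snd s)"
      using v brushes_on_dirty(2)[OF step.hyps(1)] by simp
    also have "\<dots> \<le> g v + card (nbrs G v - D)"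
      using step.IH finite_nbrs by (intro add_left_mono card_mono) auto
    finally show False using assms(2) \<open>v \<in> D\<close> by (auto simp: blocked_def)
  qed
  then show ?case using step.IH v by auto
qed

lemma position_blocked:
  assumes "position G g s"
  shows "blocked G g (snd s)"
proof -
  have s: "(fires G)\<^sup>*\<^sup>* (g, pverts G) s" "stable G s" using assms by (auto simp: position_def)
  have "fst s w < card (nbrs G w \<inter> snd s)" if "w \<in> snd s" for w
    using fires.intros[of w "snd s" G "fst s"] that s(2)
    unfolding stable_def dirty_nbrs_eq by (metis not_less prod.collapse)
  then show ?thesis using brushes_on_dirty[OF s(1)] by (auto simp: blocked_def)
qed

lemma position_dirty_subset: "position G g s \<Longrightarrow> snd s \<subseteq> pverts G"
  using position_blocked by (auto simp: blocked_def)

lemma position_blocked_subset: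
  "position G g s \<Longrightarrow> blocked G g D \<Longrightarrow> D \<subseteq> snd s"
  using blocked_subset_dirty[of g s D] by (simp add: position_def)

lemma cleans_iff_no_blocked: "cleans G g \<longleftrightarrow> (\<forall>D. blocked G g D \<longrightarrow> D = {})"
proof
  assume "cleans G g"
  then show "\<forall>D. blocked G g D \<longrightarrow> D = {}"
    unfolding cleans_def using blocked_subset_dirty by fastforce
next
  assume *: "\<forall>D. blocked G g D \<longrightarrow> D = {}"
  obtain s where "position G g s"
    using settled_exists[of "(g, pverts G)" G] finite_verts by (auto simp: position_def)
  then show "cleans G g"
    using * position_blocked unfolding cleans_def position_def by (metis prod.collapse)
qed

text \<open>An additional brush never prevents a firing, so it can be put down before the others have been
  processed. This is what makes \<^const>\<open>position\<close> an invariant of the game.\<close>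

lemma fires_add_brush:
  assumes "(fires G)\<^sup>*\<^sup>* (g, D) s"
  shows "(fires G)\<^sup>*\<^sup>* (g(v := g v + 1), D) ((fst s)(v := fst s v + 1), snd s)"
  using assms
proof induction
  case base
  then show ?case by simp
next
  case (step s t)
  obtain f E u where st: "s = (f, E)" "u \<in> E" "card (dirty_nbrs G E u) \<le> f u"
      "t = (\<lambda>w. if w \<in> dirty_nbrs G E u then f w + 1 else f w, E - {u})"
    using step.hyps(2) by cases fastforce
  let ?f = "f(v := f v + 1)"
  have "fires G (?f, E) (\<lambda>w. if w \<in> dirty_nbrs G E u then ?f w + 1 else ?f w, E - {u})"
    using st by (intro fires.intros) auto
  also have "(\<lambda>w. if w \<in> dirty_nbrs G E u then ?f w + 1 else ?f w) = (fst t)(v := fst t v + 1)"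
    using st by auto
  finally show ?case using step.IH st by (auto intro: rtranclp.rtrancl_into_rtrancl)
qed

lemma position_turn:
  assumes "position G g s"
  shows "position G (g(v := g v + 1)) (turn G v s)"
proof -
  have "finite (snd s)"
    using position_dirty_subset[OF assms] finite_verts by (auto intro: finite_subset)
  then show ?thesis
    using fires_add_brush[of g "pverts G" s v] assms
      settle[of "((fst s)(v := fst s v + 1), snd s)" G]
    unfolding position_def turn_def by (auto intro: rtranclp_trans)
qed

lemma dirty_turn_subset:
  assumes "position G g s"
  shows "snd (turn G v s) \<subseteq> snd s"
proof -
  have "finite (snd s)"
    using position_dirty_subset[OF assms] finite_verts by (auto intro: finite_subset)
  then show ?thesis
    using settle(1)[of "((fst s)(v := fst s v + 1), snd s)" G]
      fires_rtranclp_dirty[of G "((fst s)(v := fst s v + 1), snd s)" "turn G v s"]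
    unfolding turn_def by auto
qed

section \<open>Strategies and the length of the game\<close>

lemma game_length_step:
  assumes "position G g s" "snd s \<noteq> {}"
  shows "v \<in> snd s \<Longrightarrow> game_length G True s \<le> 1 + game_length G False (turn G v s)"
    "v \<in> snd s \<Longrightarrow> 1 + game_length G True (turn G v s) \<le> game_length G False s"
    "\<exists>v\<in>snd s. game_length G m s = 1 + game_length G (\<not> m) (turn G v s)"
proof -
  have fin: "finite (snd s)"
    using position_dirty_subset[OF assms(1)] finite_verts by (auto intro: finite_subset)
  show "v \<in> snd s \<Longrightarrow> game_length G True s \<le> 1 + game_length G False (turn G v s)"
    "v \<in> snd s \<Longrightarrow> 1 + game_length G True (turn G v s) \<le> game_length G False s"
    using assms(2) fin by (auto simp: game_length.simps[of G _ s])
  let ?X = "(\<lambda>v. game_length G (\<not> m) (turn G v s)) ` snd s"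
  have "(if m then Min else Max) ?X \<in> ?X"
    using assms(2) fin by (cases m) (simp_all only: if_True if_False, auto intro!: Min_in Max_in)
  then show "\<exists>v\<in>snd s. game_length G m s = 1 + game_length G (\<not> m) (turn G v s)"
    using assms(2) fin by (auto simp: game_length.simps[of G _ s])
qed

text \<open>Every move adds one brush, so a game can only end when the placed brushes clean \<open>G\<close>. To prolong it
  up to move \<open>N\<close>, Max needs a property of the placed brushes that every move of Min respects, that he
  can always restore, and under which cleaning \<open>G\<close> takes at least \<open>N\<close> brushes.\<close>

lemma game_length_ge_if_Max_strategy:
  assumes min_move: "\<And>g v. I True g \<Longrightarrow> v \<in> pverts G \<Longrightarrow> I False (g(v := g v + 1))"
    and max_move: "\<And>g s. I False g \<Longrightarrow> position G g s \<Longrightarrow> snd s \<noteq> {} \<Longrightarrow>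
      \<exists>v\<in>snd s. I True (g(v := g v + 1))"
    and final: "\<And>g m. I m g \<Longrightarrow> cleans G g \<Longrightarrow> N \<le> (\<Sum>v\<in>pverts G. g v)"
    and "I m g" "position G g s"
  shows "N \<le> (\<Sum>v\<in>pverts G. g v) + game_length G m s"
  using assms(4,5)
proof (induction "game_length G m s" arbitrary: g m s rule: less_induct)
  case less
  show ?case
  proof (cases "snd s = {}")
    case True
    then have "cleans G g"
      using less.prems(2) unfolding cleans_def position_def by (metis prod.collapse)
    then show ?thesis using final less.prems(1) by (auto intro: trans_le_add1)
  next
    case False
    note step = game_length_step[OF less.prems(2) False]
    obtain v where v: "v \<in> snd s" "I (\<not> m) (g(v := g v + 1))"
      "1 + game_length G (\<not> m) (turn G v s) \<le> game_length G m s"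
    proof (cases m)
      case True
      obtain v where v: "v \<in> snd s" "game_length G m s = 1 + game_length G (\<not> m) (turn G v s)"
        using step(3) by blast
      have "v \<in> pverts G" using v(1) position_dirty_subset[OF less.prems(2)] by blast
      then have "I (\<not> m) (g(v := g v + 1))" using min_move less.prems(1) True by simp
      then show ?thesis using v that by simp
    next
      case False
      then show ?thesis
        using max_move[of g s] less.prems \<open>snd s \<noteq> {}\<close> step(2) that by auto
    qed
    have "v \<in> pverts G" using v(1) position_dirty_subset[OF less.prems(2)] by blast
    have "N \<le> (\<Sum>x\<in>pverts G. (g(v := g v + 1)) x) + game_length G (\<not> m) (turn G v s)"
      using v(3) by (intro less.hyps v(2) position_turn less.prems) simp
    also have "\<dots> \<le> (\<Sum>x\<in>pverts G. g x) + game_length G m s"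
      using v(3) \<open>v \<in> pverts G\<close> by (simp only: sum_add_brush[OF finite_verts]) simp
    finally show ?thesis .
  qed
qed

text \<open>Dually, Min uses an estimate \<open>U\<close> of the remaining number of moves that every move of Max lowers and
  that Min can always lower too. It may depend on the dirty vertices besides the placed brushes.\<close>

lemma game_length_le_if_Min_strategy:
  fixes U :: "bool \<Rightarrow> ('a \<Rightarrow> nat) \<Rightarrow> 'a set \<Rightarrow> nat"
  assumes max_move: "\<And>g g' s s' v. position G g s \<Longrightarrow> v \<in> snd s \<Longrightarrow>
      g' = g(v := g v + 1) \<Longrightarrow> s' = turn G v s \<Longrightarrow> U True g' (snd s') < U False g (snd s)"
    and min_move: "\<And>g s. position G g s \<Longrightarrow> snd s \<noteq> {} \<Longrightarrow>
      \<exists>v\<in>snd s. U False (g(v := g v + 1)) (snd (turn G v s)) < U True g (snd s)"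
    and "position G g s"
  shows "game_length G m s \<le> U m g (snd s)"
  using assms(3)
proof (induction "U m g (snd s)" arbitrary: g m s rule: less_induct)
  case less
  show ?case
  proof (cases "snd s = {}")
    case True
    then show ?thesis by (simp add: game_length.simps)
  next
    case False
    note step = game_length_step[OF less.prems False]
    obtain v where v: "v \<in> snd s" "game_length G m s \<le> 1 + game_length G (\<not> m) (turn G v s)"
      "U (\<not> m) (g(v := g v + 1)) (snd (turn G v s)) < U m g (snd s)"
    proof (cases m)
      case True
      then show ?thesis using min_move[OF less.prems False] step(1) that by auto
    next
      case False
      obtain v where "v \<in> snd s" "game_length G m s = 1 + game_length G (\<not> m) (turn G v s)"
        using step(3) by blast
      then show ?thesis using max_move[OF less.prems] that False by auto
    qed
    have "game_length G (\<not> m) (turn G v s) \<le> U (\<not> m) (g(v := g v + 1)) (snd (turn G v s))"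
      using v by (intro less.hyps position_turn less.prems) auto
    then show ?thesis using v by linarith
  qed
qed

end

section \<open>Two bundles of paths and a matching\<close>

text \<open>\<open>A\<close> and \<open>B\<close> are the middle vertices of the two bundles of paths \<open>a - c\<close> and \<open>c - b\<close>; the isolated
  edges join each \<open>x \<in> L\<close> to \<open>mate x\<close>.\<close>

locale bundle_graph =
  fixes a c b :: 'a and A B L :: "'a set" and mate :: "'a \<Rightarrow> 'a" and n :: nat
  assumes finite: "finite A" "finite B" "finite L"
    and card: "card A = n" "card B = n" and n_pos: "0 < n"
    and hubs: "a \<noteq> c" "a \<noteq> b" "c \<noteq> b"
    and disjoint: "{a, c, b} \<inter> (A \<union> B) = {}" "A \<inter> B = {}"
      "({a, c, b} \<union> A \<union> B) \<inter> (L \<union> mate ` L) = {}" "L \<inter> mate ` L = {}"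
    and inj_mate: "inj_on mate L"
begin

definition edges :: "('a \<times> 'a) set" where
  "edges = {a, c} \<times> A \<union> {c, b} \<times> B \<union> (\<lambda>x. (x, mate x)) ` L"

definition G :: "'a pair_pre_digraph" where
  "G = \<lparr>pverts = {a, c, b} \<union> A \<union> B \<union> (L \<union> mate ` L), parcs = edges \<union> edges\<inverse>\<rparr>"

lemma pair_graph: "pair_graph G"
proof
  show "finite (pverts G)" "finite (parcs G)" using finite by (auto simp: G_def edges_def)
  show "symmetric G" by (auto simp: G_def symmetric_def intro: symI)
  fix e assume e: "e \<in> parcs G"
  then show "fst e \<in> pverts G" "snd e \<in> pverts G" by (auto simp: G_def edges_def)
  have "mate x \<noteq> x" if "x \<in> L" for x using that disjoint(4) by (metis disjoint_iff imageI)
  then show "fst e \<noteq> snd e" using e disjoint by (auto simp: G_def edges_def)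
qed

sublocale pair_graph G by (fact pair_graph)

lemma pverts_G: "pverts G = {a, c, b} \<union> A \<union> B \<union> (L \<union> mate ` L)"
  by (simp add: G_def)

lemma nbrs_simps:
  "nbrs G a = A" "nbrs G c = A \<union> B" "nbrs G b = B"
  "x \<in> A \<Longrightarrow> nbrs G x = {a, c}" "x \<in> B \<Longrightarrow> nbrs G x = {c, b}"
  "x \<in> L \<Longrightarrow> nbrs G x = {mate x}" "x \<in> L \<Longrightarrow> nbrs G (mate x) = {x}"
  using disjoint hubs inj_mate unfolding nbrs_def G_def edges_def
  by (auto dest: inj_onD)

lemma sum_pverts: "(\<Sum>v\<in>pverts G. g v) =
    g a + (\<Sum>x\<in>A. g x) + (g b + (\<Sum>x\<in>B. g x)) + g c + (\<Sum>x\<in>L. g x + g (mate x))"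
  for g :: "'a \<Rightarrow> nat"
proof -
  have "(\<Sum>v\<in>pverts G. g v) =
      (\<Sum>v\<in>{a, c, b}. g v) + (\<Sum>v\<in>A. g v) + (\<Sum>v\<in>B. g v) + ((\<Sum>v\<in>L. g v) + (\<Sum>v\<in>mate ` L. g v))"
    using disjoint finite unfolding pverts_G
    by (subst sum.union_disjoint[symmetric], auto)+
  then show ?thesis using hubs by (simp add: sum.distrib sum.reindex[OF inj_mate])
qed

text \<open>As long as no hub can be paid for, the hubs stay dirty, and a vertex of \<open>A\<close> or \<open>B\<close> fires precisely
  if it holds two brushes. Each of these has used up two brushes to shift the balance of its hubs by
  two, so the number of brushes on and around a hub bounds the progress that it has made.\<close>

lemma blocked_while_hubs_dirty:
  assumes "g a + (\<Sum>x\<in>A. g x) < n" "g b + (\<Sum>x\<in>B. g x) < n"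
    and "g a + (\<Sum>x\<in>A. g x) + (g b + (\<Sum>x\<in>B. g x)) + g c < 2 * n"
  shows "blocked G g ({a, c, b} \<union> {x \<in> A \<union> B. g x < 2})" (is "blocked G g ?D")
proof -
  have spent: "2 * card (S - ?D) \<le> (\<Sum>x\<in>S. g x)" if "S = A \<or> S = B" for S
  proof -
    have "2 * card (S - ?D) \<le> (\<Sum>x\<in>S - ?D. g x)"
      using that sum_mono[of "S - ?D" "\<lambda>_. 2" g] by force
    also have "\<dots> \<le> (\<Sum>x\<in>S. g x)" using that finite by (intro sum_mono2) auto
    finally show ?thesis .
  qed
  have split: "card (S \<inter> ?D) + card (S - ?D) = n" if "S = A \<or> S = B" for S
  proof -
    have "card (S \<inter> ?D) + card (S - ?D) = card S"
      using that finite by (subst card_Un_disjoint[symmetric]) (auto intro: arg_cong[of _ _ card])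
    then show ?thesis using that card by auto
  qed
  have AB: "card ((A \<union> B) - ?D) = card (A - ?D) + card (B - ?D)"
    "card ((A \<union> B) \<inter> ?D) = card (A \<inter> ?D) + card (B \<inter> ?D)"
    using disjoint(2) finite
    by (subst card_Un_disjoint[symmetric]; auto intro!: arg_cong[of _ _ card])+
  note bounds = spent[OF disjI1[OF refl]] spent[OF disjI2[OF refl]]
    split[OF disjI1[OF refl]] split[OF disjI2[OF refl]]
  have "g w + card (nbrs G w - ?D) < card (nbrs G w \<inter> ?D)" if w: "w \<in> ?D" for w
  proof -
    consider "w = a" | "w = c" | "w = b" | "w \<in> A" "g w < 2" | "w \<in> B" "g w < 2"
      using w by blast
    then show ?thesis
    proof cases
      case 1
      show ?thesis using bounds assms unfolding 1 nbrs_simps by linarith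
    next
      case 2
      show ?thesis using bounds AB assms unfolding 2 nbrs_simps by linarith
    next
      case 3
      show ?thesis using bounds assms unfolding 3 nbrs_simps by linarith
    next
      case 4
      then show ?thesis using hubs by (simp add: nbrs_simps)
    next
      case 5
      then show ?thesis using hubs by (simp add: nbrs_simps)
    qed
  qed
  then show ?thesis unfolding blocked_def pverts_G by auto
qed

lemma blocked_mates:
  assumes "x \<in> L" "g x + g (mate x) = 0"
  shows "blocked G g {x, mate x}"
proof -
  have "x \<noteq> mate x" using assms(1) disjoint(4) by auto
  then show ?thesis using assms by (auto simp: blocked_def nbrs_simps pverts_G)
qed

lemma mates_unbrushed_if_blocked:
  assumes "blocked G g D" "x \<in> L" "x \<in> D \<or> mate x \<in> D"
  shows "g x + g (mate x) = 0"
proof -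
  have *: "w \<in> D \<Longrightarrow> g w + card (nbrs G w - D) < card (nbrs G w \<inter> D)" for w
    using assms(1) by (auto simp: blocked_def)
  have "x \<in> D \<and> mate x \<in> D"
  proof (rule ccontr)
    assume "\<not> (x \<in> D \<and> mate x \<in> D)"
    then show False using *[of x] *[of "mate x"] assms(2,3) by (auto simp: nbrs_simps)
  qed
  then show ?thesis using *[of x] *[of "mate x"] assms(2) by (auto simp: nbrs_simps)
qed

text \<open>Once \<open>a\<close> is clean, the sweep proceeds by itself: the vertices of \<open>A\<close> have one brush from \<open>a\<close> and only
  the neighbour \<open>c\<close> left, then \<open>c\<close> has \<open>n\<close> brushes for the \<open>n\<close> vertices of \<open>B\<close>, and so on.\<close>

lemma blocked_subset_matching:
  assumes "blocked G g D" "a \<notin> D"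
  shows "D \<subseteq> L \<union> mate ` L"
proof -
  have *: "w \<in> D \<Longrightarrow> g w + card (nbrs G w - D) < card (nbrs G w \<inter> D)" for w
    using assms(1) by (auto simp: blocked_def)
  have A: "A \<inter> D = {}"
  proof (rule ccontr)
    assume "A \<inter> D \<noteq> {}"
    then obtain x where x: "x \<in> A" "x \<in> D" by blast
    show False using *[OF x(2)] x(1) assms(2) hubs by (auto simp: nbrs_simps insert_Diff_if Int_insert_left split: if_splits)
  qed
  have c: "c \<notin> D"
  proof
    assume "c \<in> D"
    have "n \<le> card ((A \<union> B) - D)"
      using A card(1) finite by (metis Diff_triv Un_Diff Un_upper1 card_mono finite_Diff finite_UnI)
    moreover have "card ((A \<union> B) \<inter> D) \<le> n"
      using A card(2) finite by (metis Int_Un_distrib2 Int_lower1 card_mono sup_bot_left)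
    ultimately show False using *[OF \<open>c \<in> D\<close>] by (simp add: nbrs_simps)
  qed
  have B: "B \<inter> D = {}"
  proof (rule ccontr)
    assume "B \<inter> D \<noteq> {}"
    then obtain x where x: "x \<in> B" "x \<in> D" by blast
    show False using *[OF x(2)] x(1) c hubs by (auto simp: nbrs_simps insert_Diff_if Int_insert_left split: if_splits)
  qed
  have "b \<notin> D" using *[of b] B by (auto simp: nbrs_simps Int_commute)
  then show ?thesis using A B c assms by (auto simp: blocked_def pverts_G)
qed

text \<open>The costs that no configuration avoids: one brush for each isolated edge, and the price of the first
  hub to fire. The sums for \<open>a\<close> and \<open>b\<close> keep the brushes at the two ends apart from those on
  \<open>c\<close>, as the game requires.\<close>

lemma brushes_if_cleans:
  assumes "cleans G g"
  shows "card L \<le> (\<Sum>x\<in>L. g x + g (mate x))"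
    "n \<le> g a + (\<Sum>x\<in>A. g x) \<or> n \<le> g b + (\<Sum>x\<in>B. g x) \<or>
     2 * n \<le> g a + (\<Sum>x\<in>A. g x) + (g b + (\<Sum>x\<in>B. g x)) + g c"
proof -
  have *: "\<not> blocked G g D" if "D \<noteq> {}" for D
    using assms that by (auto simp: cleans_iff_no_blocked)
  have "1 \<le> g x + g (mate x)" if "x \<in> L" for x
    using *[of "{x, mate x}"] blocked_mates[OF that, of g] by (cases "g x + g (mate x)") auto
  then show "card L \<le> (\<Sum>x\<in>L. g x + g (mate x))"
    using sum_mono[of L "\<lambda>_. 1" "\<lambda>x. g x + g (mate x)"] by simp
  show "n \<le> g a + (\<Sum>x\<in>A. g x) \<or> n \<le> g b + (\<Sum>x\<in>B. g x) \<or>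
     2 * n \<le> g a + (\<Sum>x\<in>A. g x) + (g b + (\<Sum>x\<in>B. g x)) + g c"
    using *[of "{a, c, b} \<union> {x \<in> A \<union> B. g x < 2}"] blocked_while_hubs_dirty[of g]
    by (meson Un_empty insert_not_empty not_less)
qed

text \<open>Here \<open>n > 0\<close> matters: isolated vertices fire without any brush, so in their presence the initial
  state is not stable.\<close>

lemma start_position: "position G (\<lambda>_. 0) (\<lambda>_. 0, pverts G)"
proof -
  have "dirty_nbrs G (pverts G) v \<noteq> {}" if "v \<in> pverts G" for v
    using that n_pos card nbrs_subset[of v]
    by (auto simp: dirty_nbrs_eq Int_absorb2 pverts_G nbrs_simps)
  then have pos: "0 < card (dirty_nbrs G (pverts G) v)" if "v \<in> pverts G" for v
    using that finite_nbrs[of v] by (simp add: dirty_nbrs_eq card_gt_0_iff)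
  have "\<not> fires G (\<lambda>_. 0, pverts G) s" for s
    by (rule notI, erule fires.cases) (use pos in force)
  then show ?thesis by (simp add: position_def stable_def)
qed

section \<open>The brush number\<close>

lemma brush_number_eq: "brush_number G = n + card L"
  unfolding brush_number_def
proof (rule Least_equality)
  let ?g = "\<lambda>v. if v = a then n else if v \<in> L then 1 else 0 :: nat"
  have "D = {}" if D: "blocked G ?g D" for D
  proof -
    have "a \<notin> D"
    proof
      assume "a \<in> D"
      then have "n < card (A \<inter> D)" using D by (auto simp: blocked_def nbrs_simps)
      also have "\<dots> \<le> n" using card finite by (metis Int_lower1 card_mono)
      finally show False by simp
    qed
    note sub = blocked_subset_matching[OF D this]
    have "x \<notin> D \<and> mate x \<notin> D" if "x \<in> L" for x
      using mates_unbrushed_if_blocked[OF D that] that disjoint by (auto split: if_splits)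
    with sub show ?thesis by auto
  qed
  then have "cleans G ?g" by (auto simp: cleans_iff_no_blocked)
  moreover have "(\<Sum>v\<in>pverts G. ?g v) = n + card L"
  proof -
    have "(\<Sum>x\<in>S. ?g x) = 0" if "S = A \<or> S = B" for S
      using that disjoint by (intro sum.neutral) auto
    moreover have "(\<Sum>x\<in>L. ?g x + ?g (mate x)) = (\<Sum>x\<in>L. 1)"
      using disjoint by (intro sum.cong) auto
    ultimately show ?thesis using hubs disjoint by (auto simp: sum_pverts)
  qed
  ultimately show "\<exists>f. cleans G f \<and> n + card L = (\<Sum>v\<in>pverts G. f v)" by metis
next
  fix k assume "\<exists>f. cleans G f \<and> k = (\<Sum>v\<in>pverts G. f v)"
  then obtain f where f: "cleans G f" "k = (\<Sum>v\<in>pverts G. f v)" by blast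
  show "n + card L \<le> k"
    using brushes_if_cleans[OF f(1)] f(2) unfolding sum_pverts by linarith
qed

section \<open>The game brush number\<close>

text \<open>Max places brushes on \<open>c\<close> until it holds \<open>n - 1\<close>, and arbitrarily thereafter. Up to that point
  the brushes on the rest of the large component outnumber those on \<open>c\<close> by at most one, too few for
  any hub to fire; so \<open>c\<close> is available to Max, and the game cannot end before \<open>c\<close> holds \<open>n - 1\<close>.\<close>

lemma game_brush_number_ge: "2 * n - 1 + card L \<le> game_brush_number G"
proof -
  define I where "I m g \<longleftrightarrow> n - 1 \<le> g c \<or>
    g a + (\<Sum>x\<in>A. g x) + (g b + (\<Sum>x\<in>B. g x)) \<le> g c + (if m then 0 else 1)"
    for m and g :: "'a \<Rightarrow> nat"
  have add_brush: "(g(v := g v + 1)) a + (\<Sum>x\<in>A. (g(v := g v + 1)) x) +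
      ((g(v := g v + 1)) b + (\<Sum>x\<in>B. (g(v := g v + 1)) x)) =
      g a + (\<Sum>x\<in>A. g x) + (g b + (\<Sum>x\<in>B. g x)) + (if v \<in> {a, b} \<union> A \<union> B then 1 else 0)"
    for g :: "'a \<Rightarrow> nat" and v
    using hubs disjoint sum_add_brush[OF finite(1), of g v] sum_add_brush[OF finite(2), of g v]
    by auto
  have "2 * n - 1 + card L \<le>
      (\<Sum>v\<in>pverts G. (\<lambda>_. 0 :: nat) v) + game_length G True (\<lambda>_. 0, pverts G)"
  proof (rule game_length_ge_if_Max_strategy[where I = I])
    show "I False (g(v := g v + 1))" if "I True g" for g v
      using that unfolding I_def add_brush by auto
  next
    fix g s assume I: "I False g" and pos: "position G g s" and ne: "snd s \<noteq> {}"
    show "\<exists>v\<in>snd s. I True (g(v := g v + 1))"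
    proof (cases "n - 1 \<le> g c")
      case True
      then show ?thesis using ne by (auto simp: I_def)
    next
      case False
      then have "blocked G g ({a, c, b} \<union> {x \<in> A \<union> B. g x < 2})"
        using I by (intro blocked_while_hubs_dirty) (auto simp: I_def)
      then have "c \<in> snd s" using position_blocked_subset[OF pos] by auto
      moreover have "I True (g(c := g c + 1))"
        using I hubs disjoint False unfolding I_def add_brush by auto
      ultimately show ?thesis by blast
    qed
  next
    fix g m assume "I m g" "cleans G g"
    then show "2 * n - 1 + card L \<le> (\<Sum>v\<in>pverts G. g v)"
      using brushes_if_cleans[of g] n_pos unfolding I_def sum_pverts
      by (auto split: if_splits)
  next
    show "I True (\<lambda>_. 0)" by (simp add: I_def)
  qed (fact start_position)
  then show ?thesis by (simp add: game_brush_number_def)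
qed

text \<open>Min plays on \<open>a\<close> as long as \<open>a\<close> is dirty. From then on only isolated edges are left, and every move
  of either player removes one of them. The potential \<open>U\<close> counts the isolated edges without a brush
  and, as long as \<open>a\<close> is dirty, the \<open>n - g a\<close> moves that Min still has to spend there together with
  the moves of Max in between.\<close>

lemma game_brush_number_le: "game_brush_number G \<le> 2 * n - 1 + card L"
proof -
  define K where "K g = card {x \<in> L. g x + g (mate x) = 0}" for g :: "'a \<Rightarrow> nat"
  define U where "U m g D = K g + (if a \<in> D then 2 * (n - g a) - (if m then 1 else 0) else 0)"
    for m and g :: "'a \<Rightarrow> nat" and D
  have K_mono: "K (g(v := g v + 1)) \<le> K g" for g v
    unfolding K_def using finite by (intro card_mono) (auto split: if_splits)
  have a_room: "g a < n" if "position G g s" "a \<in> snd s" for g s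
  proof -
    have "g a < card (A \<inter> snd s)"
      using position_blocked[OF that(1)] that(2) by (auto simp: blocked_def nbrs_simps)
    also have "\<dots> \<le> n" using card finite by (metis Int_lower1 card_mono)
    finally show ?thesis .
  qed
  have matching_move: "K (g(v := g v + 1)) < K g"
    if pos: "position G g s" and v: "v \<in> snd s" and a: "a \<notin> snd s" for g s v
  proof -
    have D: "blocked G g (snd s)" using pos by (rule position_blocked)
    obtain x where x: "x \<in> L" "v = x \<or> v = mate x"
      using blocked_subset_matching[OF D a] v by auto
    then have "g x + g (mate x) = 0" using mates_unbrushed_if_blocked[OF D x(1)] v by auto
    then have "{y \<in> L. (g(v := g v + 1)) y + (g(v := g v + 1)) (mate y) = 0}
        \<subset> {y \<in> L. g y + g (mate y) = 0}"
      using x by (auto split: if_splits)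
    then show ?thesis unfolding K_def using finite by (intro psubset_card_mono) auto
  qed
  have "game_length G True (\<lambda>_. 0, pverts G) \<le> U True (\<lambda>_. 0) (snd (\<lambda>_ :: 'a. 0 :: nat, pverts G))"
  proof (rule game_length_le_if_Min_strategy[where U = U])
    fix g g' s s' v
    assume pos: "position G g s" and v: "v \<in> snd s" and g': "g' = g(v := g v + 1)"
      and s': "s' = turn G v s"
    have sub: "snd s' \<subseteq> snd s" using dirty_turn_subset[OF pos] s' by simp
    show "U True g' (snd s') < U False g (snd s)"
    proof (cases "a \<in> snd s")
      case True
      then show ?thesis using a_room[OF pos True] K_mono[of g v] g' by (auto simp: U_def)
    next
      case False
      then show ?thesis using matching_move[OF pos v False] sub g' by (auto simp: U_def)
    qed
  next
    fix g s assume pos: "position G g s" and ne: "snd s \<noteq> {}"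
    show "\<exists>v\<in>snd s. U False (g(v := g v + 1)) (snd (turn G v s)) < U True g (snd s)"
    proof (cases "a \<in> snd s")
      case True
      have "U False (g(a := g a + 1)) (snd (turn G a s)) < U True g (snd s)"
        using True a_room[OF pos True] K_mono[of g a] by (auto simp: U_def)
      with True show ?thesis by blast
    next
      case False
      obtain v where v: "v \<in> snd s" using ne by blast
      have "U False (g(v := g v + 1)) (snd (turn G v s)) < U True g (snd s)"
        using matching_move[OF pos v False] dirty_turn_subset[OF pos, of v] False
        by (auto simp: U_def)
      with v show ?thesis by blast
    qed
  qed (fact start_position)
  then show ?thesis by (simp add: game_brush_number_def U_def K_def pverts_G)
qed

lemma game_brush_number_eq: "game_brush_number G = 2 * n - 1 + card L"
  using game_brush_number_ge game_brush_number_le by (rule antisym[rotated])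

end

section \<open>All ratios\<close>

lemma bundle_graph_exists:
  assumes "0 < n"
  obtains G :: "nat pair_pre_digraph"
  where "pair_graph G" "brush_number G = n + t" "game_brush_number G = 2 * n - 1 + t"
proof -
  interpret bundle_graph 0 1 2 "{3..<3 + n}" "{3 + n..<3 + 2 * n}"
    "{3 + 2 * n..<3 + 2 * n + t}" "\<lambda>x. x + t" n
    using assms by unfold_locales auto
  show ?thesis
    using that[OF pair_graph] brush_number_eq game_brush_number_eq by simp
qed

theorem theorem3:
  fixes r :: rat
  assumes "1 \<le> r" and "r < 2"
  shows "\<exists>G :: nat pair_pre_digraph. pair_graph G \<and>
           of_nat (game_brush_number G) / of_nat (brush_number G) = r"
proof -
  obtain p q where pq: "r = of_int p / of_int q" "0 < q"
    by (cases r) (auto simp: Fract_of_int_quotient)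
  \<comment> \<open>For \<open>r = p / q\<close>, Max shall waste \<open>n - 1 = p - q\<close> brushes while the brush number is
    \<open>n + t = q\<close>; the bound \<open>r < 2\<close> makes \<open>t\<close> nonnegative.\<close>
  define n where "n = nat (p - q) + 1"
  define t where "t = nat q - n"
  have p: "q \<le> p" "p < 2 * q" using assms pq by (auto simp: field_simps simp flip: of_int_mult)
  obtain G :: "nat pair_pre_digraph" where G: "pair_graph G" "brush_number G = n + t"
      "game_brush_number G = 2 * n - 1 + t"
    using bundle_graph_exists[of n t] by (auto simp: n_def)
  have "n + t = nat q" "2 * n - 1 + t = nat p" using p by (auto simp: n_def t_def)
  then have "of_nat (game_brush_number G) / of_nat (brush_number G) = r"
    using G p pq by simp
  with G(1) show ?thesis by blast
qed

end
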